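(* Let $\nu\ge 0$ and let $g\in C^\infty(0,\infty)$ have support $[a,b]$ with $0<a<b<\infty$, so that in particular $\lim_{x\to+\infty}g(x)=0$ and $\lim_{x\to+\infty}g'(x)=0$. Then for all $x>0$ $$ (B_{\nu,-}^{-1}B_\nu g)(x)=g(x). $$
   Context: For $\nu\ge 0$ the Bessel operator on $(0,\infty)$ is $B_\nu g(x)=g''(x)+\frac{\nu}{x}g'(x)$. For $\nu\ge0$, $\alpha>0$ the fractional Bessel integral on the semiaxis $(0,\infty)$ is defined by $$ (B_{\nu,-}^{-\alpha}f)(x)=\frac{1}{\Gamma(2\alpha)}\int_x^{+\infty}\left(\frac{y^2-x^2}{2y}\right)^{2\alpha-1}{}_2F_1\left(\alpha+\frac{\nu-1}{2},\alpha;2\alpha;1-\frac{x^2}{y^2}\right)f(y)\,dy,\qquad x>0, $$ where ${}_2F_1$ is the Gauss hypergeometric function; $B_{\nu,-}^{-1}$ is the case $\alpha=1$. *)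

theory Defs
  imports "HOL-Analysis.Analysis"
begin

text \<open>
  The Gauss function as the sum of its power series. This is the intended value only for
  \<open>\<bar>z\<bar> < 1\<close>; below the argument is \<open>1 - x\<^sup>2/y\<^sup>2\<close> with \<open>0 < x < y\<close>, which lies in \<open>(0,1)\<close>.
\<close>

definition gauss_2F1 :: "real \<Rightarrow> real \<Rightarrow> real \<Rightarrow> real \<Rightarrow> real" where
  "gauss_2F1 a b c z = eval_fps (fps_hypergeo [a, b] [c] 1) z"

definition bessel_op :: "real \<Rightarrow> (real \<Rightarrow> real) \<Rightarrow> real \<Rightarrow> real" where
  "bessel_op \<nu> g x = deriv (deriv g) x + \<nu> / x * deriv g x"

definition bessel_kernel :: "real \<Rightarrow> real \<Rightarrow> real \<Rightarrow> real \<Rightarrow> real" where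
  "bessel_kernel \<nu> \<alpha> x y =
     ((y\<^sup>2 - x\<^sup>2) / (2 * y)) powr (2 * \<alpha> - 1) *
     gauss_2F1 (\<alpha> + (\<nu> - 1) / 2) \<alpha> (2 * \<alpha>) (1 - x\<^sup>2 / y\<^sup>2)"

text \<open>
  The operator \<open>B\<close> with subscript \<open>\<nu>,-\<close> and exponent \<open>-\<alpha>\<close> (note the sign); the integral is
  a Lebesgue integral, meaningful when the integrand is integrable on \<open>(x,\<infinity>)\<close>.
\<close>

definition frac_bessel_integral :: "real \<Rightarrow> real \<Rightarrow> (real \<Rightarrow> real) \<Rightarrow> real \<Rightarrow> real" where
  "frac_bessel_integral \<nu> \<alpha> f x =
     1 / Gamma (2 * \<alpha>) * (LBINT y:{x<..}. bessel_kernel \<nu> \<alpha> x y * f y)"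

text \<open>
  Smoothness on an open set. At points of an open set \<open>S\<close> the iterated \<open>deriv\<close> depends only on
  the values of \<open>g\<close> on \<open>S\<close>, and differentiability at every order gives continuity of all derivatives.
\<close>

definition smooth_on_open :: "real set \<Rightarrow> (real \<Rightarrow> real) \<Rightarrow> bool" where
  "smooth_on_open S g \<longleftrightarrow> open S \<and> (\<forall>n. \<forall>x\<in>S. ((deriv ^^ n) g) differentiable (at x))"

end

theory Submission
  imports Defs
begin

text \<open>
  The series \<open>z \<cdot> \<^sub>2F\<^sub>1(p, 1; 2; z)\<close> has derivative \<open>(1 - z) powr (-p)\<close> by the binomial theorem.
  Hence the kernel \<open>K(y) = bessel_kernel \<nu> 1 x y\<close> vanishes at \<open>y = x\<close> and solves
  \<open>K' = 1 + \<nu> K / y\<close>, which makes \<open>K g' - g\<close> an antiderivative of \<open>K \<cdot> B\<^sub>\<nu> g\<close>.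
  This antiderivative is \<open>- g(x)\<close> at \<open>x\<close> and vanishes beyond the support of \<open>g\<close>.
\<close>

lemma sums_pochhammer_binomial:
  fixes p z :: real
  assumes "\<bar>z\<bar> < 1"
  shows "(\<lambda>n. pochhammer p n / fact n * z ^ n) sums (1 - z) powr (- p)"
proof -
  \<comment> \<open>The sign \<open>(- 1) ^ n\<close> hidden in \<open>(- p) gchoose n\<close>
    cancels against the one in \<open>(- z) ^ n\<close>.\<close>
  have "((- p) gchoose n) * (- z) ^ n = pochhammer p n / fact n * z ^ n" for n
    using power_mult_distrib[of "- 1" "- z" n] by (simp add: gbinomial_pochhammer)
  with gen_binomial_real[of "- z" "- p"] assms show ?thesis
    by simp
qed

text \<open>In (p)_n (1)_n / ((2)_n n!) the factor (1)_n = n! cancels, and (2)_n = (n+1)!.\<close>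

lemma fps_hypergeo_1_2_nth:
  "fps_nth (fps_hypergeo [p, 1] [2] 1) n = pochhammer p n / (fact (Suc n) :: real)"
proof -
  have "pochhammer (2::real) n = fact (Suc n)"
    using pochhammer_rec[of "1::real" n] by (simp add: pochhammer_fact[symmetric])
  then show ?thesis
    by (simp add: pochhammer_fact[symmetric])
qed

text \<open>Each coefficient is that of the binomial series of \<open>(1 - z) powr (- p)\<close>
  divided by n+1, so absolute convergence for |z| < 1 is inherited by comparison.\<close>

lemma fps_conv_radius_hypergeo_1_2:
  fixes p :: real
  shows "fps_conv_radius (fps_hypergeo [p, 1] [2] 1) \<ge> 1"
  unfolding fps_conv_radius_def
proof (rule conv_radius_geI_ex')
  fix r :: real
  assume r: "0 < r" "ereal r < 1"
  let ?c = "\<lambda>n. pochhammer p n / fact n"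
  have "1 \<le> conv_radius ?c"
  proof (rule conv_radius_geI_ex')
    fix s :: real
    assume "0 < s" "ereal s < 1"
    then show "summable (\<lambda>n. ?c n * of_real s ^ n)"
      using sums_pochhammer_binomial[of s p] by (auto simp: sums_iff)
  qed
  with r have "ereal (norm r) < conv_radius ?c"
    using less_le_trans[of "ereal r" 1] by simp
  then have "summable (\<lambda>n. norm (?c n * r ^ n))"
    by (rule abs_summable_in_conv_radius)
  then show "summable (\<lambda>n. fps_nth (fps_hypergeo [p, 1] [2] 1) n * of_real r ^ n)"
  proof (rule summable_comparison_test')
    fix n :: nat
    have "\<bar>pochhammer p n\<bar> / fact (Suc n) \<le> \<bar>pochhammer p n\<bar> / fact n"
      by (intro divide_left_mono fact_mono) auto
    from mult_right_mono[OF this, of "r ^ n"] r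
    show "norm (fps_nth (fps_hypergeo [p, 1] [2] 1) n * of_real r ^ n) \<le> norm (?c n * r ^ n)"
      unfolding fps_hypergeo_1_2_nth by (simp add: abs_mult del: fact_Suc)
  qed
qed

lemma DERIV_mult_gauss_2F1:
  assumes "\<bar>z\<bar> < 1"
  shows "((\<lambda>z. z * gauss_2F1 p 1 2 z) has_real_derivative (1 - z) powr (- p)) (at z)"
proof -
  define h where "h = fps_hypergeo [p, 1] [2] (1 :: real)"
  have lt: "ereal (norm u) < fps_conv_radius h" if "\<bar>u\<bar> < 1" for u :: real
    unfolding h_def
    by (rule less_le_trans[OF _ fps_conv_radius_hypergeo_1_2]) (use that in simp)
  have eval: "eval_fps (fps_X * h) u = u * gauss_2F1 p 1 2 u" if "\<bar>u\<bar> < 1" for u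
    using lt[OF that] by (subst eval_fps_mult) (auto simp: gauss_2F1_def h_def)
  have "fps_conv_radius h \<le> fps_conv_radius (fps_X * h)"
    using fps_conv_radius_mult[of fps_X h] by simp
  with lt assms have "ereal (norm z) < fps_conv_radius (fps_X * h)"
    using less_le_trans by blast
  from has_field_derivative_eval_fps[OF this]
  have "(eval_fps (fps_X * h) has_real_derivative eval_fps (fps_deriv (fps_X * h)) z) (at z)" .
  \<comment> \<open>Multiplication by \<open>fps_X\<close> moves the coefficient (p)_n / (n+1)! to
    degree n+1, and differentiation then multiplies it by n+1, which leaves the binomial
    coefficient.\<close>
  moreover have "fps_nth (fps_deriv (fps_X * h)) n = pochhammer p n / fact n" for n
    unfolding h_def fps_deriv_nth fps_mult_fps_X_commute[symmetric]
    by (simp add: fps_hypergeo_1_2_nth add_nonneg_eq_0_iff divide_simps del: fps_hypergeo_nth)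
  then have "eval_fps (fps_deriv (fps_X * h)) z = (1 - z) powr (- p)"
    using sums_pochhammer_binomial[OF assms, of p] by (simp add: eval_fps_def sums_iff)
  \<comment> \<open>The product rule for \<open>eval_fps\<close> is available only where
    \<open>h\<close> converges, so the derivative is transferred through agreement near
    \<open>z\<close>.\<close>
  moreover have "\<forall>\<^sub>F u in nhds z. \<bar>u\<bar> < 1"
    using assms by (intro eventually_nhds_in_open[of "{u. \<bar>u\<bar> < 1}", simplified])
      (auto intro!: open_Collect_less continuous_intros)
  then have "\<forall>\<^sub>F u in nhds z. eval_fps (fps_X * h) u = u * gauss_2F1 p 1 2 u"
    by (rule eventually_mono) (rule eval)
  from DERIV_cong_ev[OF refl this refl] calculation show ?thesis
    by simp
qed

text \<open>
  The kernel for \<open>\<alpha> = 1\<close> without the real power, so that it is differentiable at \<open>y = x\<close> as well.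
\<close>

definition bessel_kernel_1 :: "real \<Rightarrow> real \<Rightarrow> real \<Rightarrow> real" where
  "bessel_kernel_1 \<nu> x y =
     y / 2 * ((1 - x\<^sup>2 / y\<^sup>2) * gauss_2F1 ((\<nu> + 1) / 2) 1 2 (1 - x\<^sup>2 / y\<^sup>2))"

lemma bessel_kernel_eq_bessel_kernel_1:
  assumes "0 < x" "x \<le> y"
  shows "bessel_kernel \<nu> 1 x y = bessel_kernel_1 \<nu> x y"
proof -
  have "x\<^sup>2 \<le> y\<^sup>2"
    using assms by (intro power_mono) auto
  \<comment> \<open>For y \<ge> x the base is nonnegative, so the power with exponent 2\<alpha> - 1
    = 1 is the base itself.\<close>
  then have "((y\<^sup>2 - x\<^sup>2) / (2 * y)) powr 1 = y / 2 * (1 - x\<^sup>2 / y\<^sup>2)"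
    using assms by (simp add: field_simps power2_eq_square)
  moreover have "1 + (\<nu> - 1) / 2 = (\<nu> + 1) / 2" "2 * 1 - 1 = (1 :: real)" "2 * 1 = (2 :: real)"
    by (simp_all add: field_simps)
  ultimately show ?thesis
    unfolding bessel_kernel_def bessel_kernel_1_def by (simp only: mult.assoc)
qed

text \<open>With K(t) = t/2 w(t), the product rule gives K' = w/2 + (t/x)^(\<nu>-1). A linear
  relation between w and this power then eliminates the power.\<close>

lemma DERIV_bessel_kernel_1:
  assumes "0 < x" "x \<le> y"
  shows "(bessel_kernel_1 \<nu> x has_real_derivative 1 + \<nu> / y * bessel_kernel_1 \<nu> x y) (at y)"
proof -
  define w where "w t = (1 - x\<^sup>2 / t\<^sup>2) * gauss_2F1 ((\<nu> + 1) / 2) 1 2 (1 - x\<^sup>2 / t\<^sup>2)" for t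
  have w: "(w has_real_derivative 2 / t * (t / x) powr (\<nu> - 1)) (at t)" if "x \<le> t" for t
  proof -
    have t: "0 < t" using assms that by simp
    have "x\<^sup>2 \<le> t\<^sup>2"
      using assms that by (intro power_mono) auto
    then have z: "\<bar>1 - x\<^sup>2 / t\<^sup>2\<bar> < 1"
      using assms t by (simp add: abs_less_iff)
    have "((\<lambda>t. 1 - x\<^sup>2 / t\<^sup>2) has_real_derivative 2 * x\<^sup>2 / t ^ 3) (at t)"
      using t by (auto intro!: derivative_eq_intros simp: field_simps eval_nat_numeral)
    from DERIV_chain2[OF DERIV_mult_gauss_2F1[OF z, of "(\<nu> + 1) / 2"] this]
    have "(w has_real_derivative
        (1 - (1 - x\<^sup>2 / t\<^sup>2)) powr (- ((\<nu> + 1) / 2)) * (2 * x\<^sup>2 / t ^ 3)) (at t)"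
      unfolding w_def .
    moreover have "(1 - (1 - x\<^sup>2 / t\<^sup>2)) powr (- ((\<nu> + 1) / 2)) = (t / x) powr (\<nu> + 1)"
    proof -
      \<comment> \<open>The argument of the hypergeometric function is 1 - (x/t)^2, so the binomial
        factor becomes a pure power of t/x.\<close>
      have "1 - (1 - x\<^sup>2 / t\<^sup>2) = (t / x) powr (- 2)"
        using assms t by (simp add: powr_minus powr_numeral field_simps)
      moreover have "- 2 * - ((\<nu> + 1) / 2) = \<nu> + 1"
        by (simp add: field_simps)
      ultimately show ?thesis
        by (simp only: powr_powr)
    qed
    moreover have "(t / x) powr (\<nu> + 1) = (t / x) powr (\<nu> - 1) * (t / x)\<^sup>2"
      using assms t powr_add[of "t / x" "\<nu> - 1" 2] by (simp add: powr_numeral add.commute)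
    moreover have "c * (t / x)\<^sup>2 * (2 * x\<^sup>2 / t ^ 3) = 2 / t * c" for c
      using assms t by (simp add: field_simps eval_nat_numeral)
    ultimately show ?thesis
      by simp
  qed
  \<comment> \<open>\<open>Q\<close> is the conserved quantity that encodes the relation between
    \<open>w\<close> and the power. Solving for the power rather than for \<open>w\<close> avoids
    dividing by \<nu> - 1, so the logarithmic case \<nu> = 1 needs no separate treatment.\<close>
  define Q where "Q t = (1 - \<nu>) / 2 * w t + (t / x) powr (\<nu> - 1)" for t
  have "(Q has_real_derivative 0) (at t within {x..})" if "t \<in> {x..}" for t
  proof -
    have t: "0 < t" "x \<le> t" using assms that by auto
    have "((\<lambda>t. (t / x) powr (\<nu> - 1)) has_real_derivative
        (\<nu> - 1) * (t / x) powr (\<nu> - 1) / t) (at t)"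
      using assms t powr_diff[of "t / x" "\<nu> - 1" 1]
      by (auto intro!: derivative_eq_intros simp: field_simps)
    from DERIV_add[OF DERIV_cmult[OF w[OF t(2)], of "(1 - \<nu>) / 2"] this]
    have "(Q has_real_derivative 0) (at t)"
      unfolding Q_def using t by (simp add: field_simps)
    then show ?thesis
      by (rule DERIV_subset) simp
  qed
  then obtain c where "\<And>t. t \<in> {x..} \<Longrightarrow> Q t = c"
    using has_field_derivative_zero_constant[of "{x..}" Q] by auto
  then have "Q y = Q x"
    using assms by simp
  also have "Q x = 1"
    using assms by (simp add: Q_def w_def)
  finally have Q: "(y / x) powr (\<nu> - 1) = 1 - (1 - \<nu>) / 2 * w y"
    by (simp add: Q_def)
  have "((\<lambda>t. t / 2 * w t) has_real_derivative
      1 / 2 * w y + 2 / y * (y / x) powr (\<nu> - 1) * (y / 2)) (at y)"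
    using DERIV_mult[OF DERIV_cdivide[OF DERIV_ident, of 2] w[OF assms(2)]] by simp
  moreover have "1 / 2 * w y + 2 / y * (y / x) powr (\<nu> - 1) * (y / 2) = 1 + \<nu> / y * (y / 2 * w y)"
    unfolding Q using assms by (simp add: field_simps)
  moreover have "bessel_kernel_1 \<nu> x = (\<lambda>t. t / 2 * w t)"
    by (simp add: fun_eq_iff bessel_kernel_1_def w_def)
  ultimately show ?thesis
    by simp
qed

text \<open>Stated with \<open>has_bochner_integral\<close> so that integrability and the value come
  together. The cutoff \<open>c\<close> reduces the half-line to a compact interval.\<close>

lemma has_bochner_integral_bessel_kernel_bessel_op:
  assumes x: "0 < x" "x < c"
    and g: "smooth_on_open {0<..} g"
    and zero: "\<And>y. c \<le> y \<Longrightarrow> g y = 0 \<and> deriv g y = 0 \<and> deriv (deriv g) y = 0"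
  shows "has_bochner_integral lborel
    (\<lambda>y. indicator {x<..} y *\<^sub>R (bessel_kernel \<nu> 1 x y * bessel_op \<nu> g y)) (g x)"
proof -
  let ?K = "bessel_kernel_1 \<nu> x"
  have diff: "((deriv ^^ n) g) differentiable (at y)" if "0 < y" for n y
    using g that by (simp add: smooth_on_open_def)
  have D: "DERIV g y :> deriv g y" "DERIV (deriv g) y :> deriv (deriv g) y"
    and C: "isCont (deriv g) y" "isCont (deriv (deriv g)) y" if "0 < y" for y
    using diff[OF that, of 0] diff[OF that, of 1] diff[OF that, of 2]
    by (auto simp: DERIV_deriv_iff_real_differentiable eval_nat_numeral
        intro: differentiable_imp_continuous_within)
  have K0: "?K x = 0"
    using x by (simp add: bessel_kernel_1_def)
  have "has_bochner_integral lborel (\<lambda>y. ?K y * bessel_op \<nu> g y * indicator {x..c} y)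
      ((?K c * deriv g c - g c) - (?K x * deriv g x - g x))"
  \<comment> \<open>Two-sided derivatives are required even at the endpoint \<open>x\<close>, which
    is why \<open>bessel_kernel_1\<close> replaces \<open>bessel_kernel\<close> here.\<close>
  proof (rule has_bochner_integral_FTC_Icc_real)
    fix y assume y: "x \<le> y" "y \<le> c"
    then have "0 < y" using x by simp
    note DERIV_diff[OF DERIV_mult[OF DERIV_bessel_kernel_1[OF x(1) y(1)] D(2)[OF \<open>0 < y\<close>]]
        D(1)[OF \<open>0 < y\<close>]]
    then show "DERIV (\<lambda>y. ?K y * deriv g y - g y) y :> ?K y * bessel_op \<nu> g y"
      by (rule DERIV_cong) (simp add: bessel_op_def algebra_simps)
    have "isCont ?K y"
      using DERIV_bessel_kernel_1[OF x(1) y(1)] by (rule DERIV_isCont)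
    then show "isCont (\<lambda>y. ?K y * bessel_op \<nu> g y) y"
      unfolding bessel_op_def using C[OF \<open>0 < y\<close>] \<open>0 < y\<close> by (auto intro!: continuous_intros)
  qed (use x in simp)
  moreover have "(\<lambda>y. ?K y * bessel_op \<nu> g y * indicator {x..c} y)
      = (\<lambda>y. indicator {x<..} y *\<^sub>R (bessel_kernel \<nu> 1 x y * bessel_op \<nu> g y))"
  proof
    fix y
    \<comment> \<open>The integrands agree at every point: at y = x, where the indicators differ,
      the kernel vanishes, and beyond \<open>c\<close> the derivatives of \<open>g\<close>
      do.\<close>
    consider "y < x" | "y = x" | "x < y" "y \<le> c" | "c < y"
      by linarith
    then show "?K y * bessel_op \<nu> g y * indicator {x..c} y
        = indicator {x<..} y *\<^sub>R (bessel_kernel \<nu> 1 x y * bessel_op \<nu> g y)"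
      using x zero[of y] K0
      by cases (auto simp: bessel_kernel_eq_bessel_kernel_1 bessel_op_def)
  qed
  ultimately show ?thesis
    using zero[of c] K0 by simp
qed

theorem mainTheorem4:
  fixes \<nu> a b :: real and g :: "real \<Rightarrow> real"
  assumes "\<nu> \<ge> 0"
    and "0 < a" and "a < b"
    and "smooth_on_open {0<..} g"
    and "closure (support_on {0<..} g) = {a..b}"
  shows "(g \<longlongrightarrow> 0) at_top \<and> (deriv g \<longlongrightarrow> 0) at_top \<and>
    (\<forall>x>0. set_integrable lborel {x<..} (\<lambda>y. bessel_kernel \<nu> 1 x y * bessel_op \<nu> g y) \<and>
           frac_bessel_integral \<nu> 1 (bessel_op \<nu> g) x = g x)"
proof -
  have g0: "g y = 0" if "b < y" for y
  proof (rule ccontr)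
    assume "g y \<noteq> 0"
    then have "y \<in> support_on {0<..} g"
      using assms that by (simp add: support_on_def)
    then have "y \<in> {a..b}"
      using closure_subset assms(5) by blast
    with that show False by simp
  qed
  have deriv0: "deriv f y = 0" if "\<And>t. b < t \<Longrightarrow> f t = 0" "b < y" for f :: "real \<Rightarrow> real" and y
  proof -
    \<comment> \<open>The half-line \<open>{b<..}\<close> is open, so vanishing on it passes to the
      derivative; applying this twice covers both derivatives of \<open>g\<close>.\<close>
    have "\<forall>\<^sub>F t in nhds y. f t = 0"
      using eventually_nhds_in_open[of "{b<..}" y] that by (auto elim: eventually_mono)
    then have "deriv f y = deriv (\<lambda>_. 0) y"
      by (rule deriv_cong_ev) simp
    then show ?thesis by simp
  qed
  have g1: "deriv g y = 0" if "b < y" for y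
    using deriv0 g0 that by blast
  have g2: "deriv (deriv g) y = 0" if "b < y" for y
    using deriv0 g1 that by blast
  have "(g \<longlongrightarrow> 0) at_top" "(deriv g \<longlongrightarrow> 0) at_top"
    using g0 g1 by (auto intro!: tendsto_eventually eventually_at_top_linorderI[of "b + 1"])
  moreover have "set_integrable lborel {x<..} (\<lambda>y. bessel_kernel \<nu> 1 x y * bessel_op \<nu> g y)"
    and "frac_bessel_integral \<nu> 1 (bessel_op \<nu> g) x = g x" if "0 < x" for x
  proof -
    \<comment> \<open>The cutoff \<open>max x b + 1\<close> lies beyond \<open>x\<close> and
      strictly beyond \<open>b\<close>, so points \<open>x\<close> to the right of the support are
      covered as well.\<close>
    have "has_bochner_integral lborel
        (\<lambda>y. indicator {x<..} y *\<^sub>R (bessel_kernel \<nu> 1 x y * bessel_op \<nu> g y)) (g x)"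
      by (rule has_bochner_integral_bessel_kernel_bessel_op[where c = "max x b + 1"])
        (use that assms(4) g0 g1 g2 in auto)
    \<comment> \<open>The prefactor is 1 because Gamma(2) = 1.\<close>
    then show "set_integrable lborel {x<..} (\<lambda>y. bessel_kernel \<nu> 1 x y * bessel_op \<nu> g y)"
      and "frac_bessel_integral \<nu> 1 (bessel_op \<nu> g) x = g x"
      by (simp_all add: has_bochner_integral_iff set_integrable_def
          set_lebesgue_integral_def frac_bessel_integral_def Gamma_numeral)
  qed
  ultimately show ?thesis by blast
qed

end
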